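(* For every $\delta>0$ there is $c>0$ such that the following holds for all $p\in[1/2+\delta,1]$. Let $n$ be a positive integer, let $A>0$, and suppose that a non-constant function $f\colon\{0,1\}^n\to\{0,1\}$ satisfies $\mathbb{E}_{x}[s_f(x)^{p}]\leq A$. Then there exists $i\in[n]$ such that $$I_i[f]\geq 2^{-c\left(A/\mathrm{var}(f)\right)^{1/p}}.$$
   Context: Here $x$ is uniformly distributed over $\{0,1\}^n$, $[n]=\{1,\dots,n\}$, and $\mathrm{var}(f)=\mathbb{E}_x[f(x)^2]-\mathbb{E}_x[f(x)]^2$. The sensitivity $s_f(x)$ of $f$ at $x$ is the number of coordinates $i\in[n]$ such that $f(x\oplus e_i)\neq f(x)$, where $x\oplus e_i$ is $x$ with its $i$th bit flipped. The influence of coordinate $i$ is $I_i[f]=\Pr_x[f(x)\neq f(x\oplus e_i)]$. *)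

theory Defs
  imports "HOL-Probability.Probability"
begin

text \<open>Points of \<open>{0,1}\<^sup>n\<close> are 0/1-valued functions on \<open>{1..n}\<close>, extensional
  (\<open>undefined\<close> outside \<open>{1..n}\<close>) so that there are exactly \<open>2 ^ n\<close> of them.
  A function \<open>f\<close> on the cube is a function on the ambient type of which only the values
  on \<open>cube n\<close> matter.\<close>

definition cube :: "nat \<Rightarrow> (nat \<Rightarrow> nat) set" where
  "cube n = {1..n} \<rightarrow>\<^sub>E {0, 1}"

definition flip :: "nat \<Rightarrow> (nat \<Rightarrow> nat) \<Rightarrow> (nat \<Rightarrow> nat)" where
  "flip i x = x(i := 1 - x i)"

definition unif :: "nat \<Rightarrow> (nat \<Rightarrow> nat) pmf" where
  "unif n = pmf_of_set (cube n)"

definition var :: "nat \<Rightarrow> ((nat \<Rightarrow> nat) \<Rightarrow> real) \<Rightarrow> real" where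
  "var n f = measure_pmf.expectation (unif n) (\<lambda>x. (f x)\<^sup>2)
           - (measure_pmf.expectation (unif n) f)\<^sup>2"

definition sensitivity :: "nat \<Rightarrow> ((nat \<Rightarrow> nat) \<Rightarrow> real) \<Rightarrow> (nat \<Rightarrow> nat) \<Rightarrow> nat" where
  "sensitivity n f x = card {i \<in> {1..n}. f (flip i x) \<noteq> f x}"

definition influence :: "nat \<Rightarrow> ((nat \<Rightarrow> nat) \<Rightarrow> real) \<Rightarrow> nat \<Rightarrow> real" where
  "influence n f i = measure_pmf.prob (unif n) {x. f x \<noteq> f (flip i x)}"

end

theory Submission
  imports Defs
begin

text \<open>Let \<open>F(r) = \<Sum>\<^sub>S r\<^bsup>|S|\<^esup> c\<^sub>S\<^sup>2\<close>, where
  \<open>c\<^sub>S\<close> are the Fourier coefficients of \<open>f\<close>. Then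
  \<open>F'(r)\<close> is the average over \<open>x\<close> of the inner product of the discrete
  gradient of \<open>f\<close> at \<open>x\<close>, supported on the sensitive coordinates, and the
  gradient of the multilinear extension at \<open>r x\<close>, whose entries are at most 1 and whose
  squared norm is at most \<open>1/(1 - r\<^sup>2)\<close> by Bessel's inequality. Hence
  \<open>F'(r) \<le> (A/2) (1 - r)\<^bsup>p-1\<^esup>\<close> for \<open>p \<ge> 1/2\<close>, and
  integrating shows that the Fourier weight above level \<open>d\<close> is \<open>O(A
  d\<^bsup>-p\<^esup>)\<close>; so half of the variance lies below level \<open>d\<close>, of order
  \<open>(A/var)\<^bsup>1/p\<^esup>\<close>.

  By Hoelder duality, \<open>\<Sum>\<^sub>i I\<^sub>i\<^bsup>1/p\<^esup> \<le> A\<^bsup>1/p\<^esup>\<close>. Hypercontractivity bounds the weight below level \<open>d\<close> by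
  \<open>C\<^sup>d \<Sum>\<^sub>i I\<^sub>i\<^bsup>2-1/k\<^esup>\<close>, and as \<open>1/p\<close> is bounded away from 2, for suitable \<open>k\<close> this is at most
  \<open>C\<^sup>d (max I\<^sub>i)\<^bsup>1/k\<^esup> A\<^bsup>1/p\<^esup>\<close>, which gives the lower bound on \<open>max I\<^sub>i\<close>.\<close>

text \<open>Hoelder's inequality with exponents \<open>1/(1-p)\<close> and \<open>1/p\<close>
  against the constant 1. It is used for sums over sensitive coordinates, for weights built from
  influences, and for sums over the boundary points of one coordinate.\<close>

lemma sum_powr_le:
  fixes b :: "'a \<Rightarrow> real"
  assumes S: "finite S" and b: "\<And>i. i \<in> S \<Longrightarrow> 0 \<le> b i" and K: "(\<Sum>i\<in>S. b i) \<le> K"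
    and p: "0 \<le> p" "p \<le> 1"
  shows "(\<Sum>i\<in>S. b i powr (1 - p)) \<le> K powr (1 - p) * real (card S) powr p"
proof (cases "S = {} \<or> K \<le> 0")
  case True
  \<comment> \<open>In this degenerate case every term vanishes, since
    \<open>0 powr (1 - p) = 0\<close> even at \<open>p = 1\<close>.\<close>
  have "b i = 0" if "i \<in> S" for i
  proof -
    have "b i \<le> (\<Sum>i\<in>S. b i)" using S b that by (intro member_le_sum) auto
    then show ?thesis using b[OF that] K True that by auto
  qed
  then have "(\<Sum>i\<in>S. b i powr (1 - p)) = 0" by (intro sum.neutral) auto
  then show ?thesis by simp
next
  case False
  define s where "s = real (card S)"
  have s: "s > 0" and K0: "K > 0" using False S by (auto simp: s_def card_gt_0_iff)
  \<comment> \<open>The factor \<open>(K / s) powr p\<close> makes Young's inequality tight when all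
    \<open>b i\<close> equal the mean \<open>K / s\<close>; it is cancelled at the end.\<close>
  have "(\<Sum>i\<in>S. b i powr (1 - p)) * (K / s) powr p = (\<Sum>i\<in>S. b i powr (1 - p) * (K / s) powr p)"
    by (simp add: sum_distrib_right)
  also have "\<dots> \<le> (\<Sum>i\<in>S. (1 - p) * b i + p * (K / s))"
  proof (rule sum_mono)
    fix i assume "i \<in> S"
    then show "b i powr (1 - p) * (K / s) powr p \<le> (1 - p) * b i + p * (K / s)"
      using b[of i] p K0 s Youngs_inequality_0[of "1 - p" p "b i" "K / s"] by (cases "b i = 0") auto
  qed
  also have "\<dots> = (1 - p) * (\<Sum>i\<in>S. b i) + p * K"
    using s by (simp add: sum.distrib sum_distrib_left s_def)
  also have "\<dots> \<le> (1 - p) * K + p * K"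
    using K p by (intro add_right_mono mult_left_mono) auto
  also have "\<dots> = K powr (1 - p) * s powr p * (K / s) powr p"
    using K0 s by (simp add: powr_divide algebra_simps flip: powr_add)
  finally show ?thesis using K0 s by (simp add: s_def mult_le_cancel_right)
qed

section \<open>Fourier analysis on the cube\<close>

definition avg :: "nat \<Rightarrow> ((nat \<Rightarrow> nat) \<Rightarrow> real) \<Rightarrow> real" where
  "avg n g = (\<Sum>x\<in>cube n. g x) / 2 ^ n"

definition sg :: "(nat \<Rightarrow> nat) \<Rightarrow> nat \<Rightarrow> real" where
  "sg x i = (-1) ^ x i"

definition chi :: "nat set \<Rightarrow> (nat \<Rightarrow> nat) \<Rightarrow> real" where
  "chi S x = (\<Prod>i\<in>S. sg x i)"

definition fcoef :: "nat \<Rightarrow> ((nat \<Rightarrow> nat) \<Rightarrow> real) \<Rightarrow> nat set \<Rightarrow> real" where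
  "fcoef n f S = avg n (\<lambda>x. f x * chi S x)"

lemma finite_cube [simp]: "finite (cube n)"
  by (auto simp: cube_def intro!: finite_PiE)

lemma card_cube: "card (cube n) = 2 ^ n"
  by (simp add: cube_def card_PiE numeral_2_eq_2)

lemma cube_nonempty [simp]: "cube n \<noteq> {}"
  using card_cube[of n] by (metis card.empty power_not_zero zero_neq_numeral)

lemma expectation_unif: "measure_pmf.expectation (unif n) g = avg n g"
  by (simp add: unif_def avg_def integral_pmf_of_set card_cube)

lemma cube_cases: "x \<in> cube n \<Longrightarrow> i \<in> {1..n} \<Longrightarrow> x i = 0 \<or> x i = 1"
  by (auto simp: cube_def PiE_def Pi_def)

lemma flip_in_cube: "x \<in> cube n \<Longrightarrow> i \<in> {1..n} \<Longrightarrow> flip i x \<in> cube n"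
  by (auto simp: cube_def flip_def PiE_def Pi_def extensional_def)

lemma flip_flip: "x \<in> cube n \<Longrightarrow> i \<in> {1..n} \<Longrightarrow> flip i (flip i x) = x"
  using cube_cases[of x n i] by (auto simp: flip_def)

lemma sg_sq [simp]: "sg x i * sg x i = 1"
  by (simp add: sg_def flip: power_add mult_2)

lemma abs_sg [simp]: "\<bar>sg x i\<bar> = 1"
  by (simp add: sg_def power_abs)

lemma sg_flip: "x \<in> cube n \<Longrightarrow> i \<in> {1..n} \<Longrightarrow> sg (flip i x) i = - sg x i"
  using cube_cases[of x n i] by (auto simp: flip_def sg_def)

lemma sg_flip_other: "j \<noteq> i \<Longrightarrow> sg (flip i x) j = sg x j"
  by (simp add: flip_def sg_def)

lemma chi_flip_notin: "i \<notin> S \<Longrightarrow> chi S (flip i x) = chi S x"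
  unfolding chi_def by (intro prod.cong refl sg_flip_other) auto

lemma chi_insert: "finite S \<Longrightarrow> i \<notin> S \<Longrightarrow> chi (insert i S) x = sg x i * chi S x"
  by (simp add: chi_def)

lemma chi_flip_in:
  assumes "x \<in> cube n" "i \<in> {1..n}" "finite S" "i \<in> S"
  shows "chi S (flip i x) = - chi S x"
proof -
  obtain T where T: "S = insert i T" "i \<notin> T" "finite T"
    using assms by (metis finite_insert mk_disjoint_insert)
  then show ?thesis using assms by (simp add: chi_insert chi_flip_notin sg_flip)
qed

lemma avg_cong: "(\<And>x. x \<in> cube n \<Longrightarrow> g x = h x) \<Longrightarrow> avg n g = avg n h"
  by (simp add: avg_def)

lemma avg_mono: "(\<And>x. x \<in> cube n \<Longrightarrow> g x \<le> h x) \<Longrightarrow> avg n g \<le> avg n h"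
  by (simp add: avg_def divide_right_mono sum_mono)

lemma avg_add: "avg n (\<lambda>x. g x + h x) = avg n g + avg n h"
  by (simp add: avg_def sum.distrib add_divide_distrib)

lemma avg_diff: "avg n (\<lambda>x. g x - h x) = avg n g - avg n h"
  by (simp add: avg_def sum_subtractf diff_divide_distrib)

lemma avg_cmult: "avg n (\<lambda>x. c * g x) = c * avg n g"
  by (simp add: avg_def sum_distrib_left)

lemma avg_sum: "avg n (\<lambda>x. \<Sum>i\<in>I. g i x) = (\<Sum>i\<in>I. avg n (g i))"
  by (simp add: avg_def sum_divide_distrib sum.swap[of _ I])

lemma avg_const [simp]: "avg n (\<lambda>x. c) = c"
  by (simp add: avg_def card_cube)

lemma avg_nonneg: "(\<And>x. x \<in> cube n \<Longrightarrow> 0 \<le> g x) \<Longrightarrow> 0 \<le> avg n g"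
  by (simp add: avg_def sum_nonneg)

lemma abs_avg_le: "\<bar>avg n g\<bar> \<le> avg n (\<lambda>x. \<bar>g x\<bar>)"
  by (simp add: avg_def divide_right_mono sum_abs)

lemma avg_flip:
  assumes "i \<in> {1..n}"
  shows "avg n (\<lambda>x. g (flip i x)) = avg n g"
proof -
  have "(\<Sum>x\<in>cube n. g (flip i x)) = (\<Sum>x\<in>cube n. g x)"
    by (rule sum.reindex_bij_witness[of _ "flip i" "flip i"])
       (use assms in \<open>auto simp: flip_flip flip_in_cube simp del: One_nat_def atLeastAtMost_iff\<close>)
  then show ?thesis by (simp add: avg_def)
qed

text \<open>Independence of the coordinates under the uniform measure.\<close>

lemma avg_prod: "avg n (\<lambda>z. \<Prod>l\<in>{1..n}. \<phi> l (z l)) = (\<Prod>l\<in>{1..n}. (\<phi> l 0 + \<phi> l 1) / 2)"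
proof -
  have "(\<Prod>l\<in>{1..n}. \<Sum>v\<in>{0, 1::nat}. \<phi> l v) = (\<Sum>z\<in>cube n. \<Prod>l\<in>{1..n}. \<phi> l (z l))"
    unfolding cube_def by (rule prod_sum_PiE) auto
  then show ?thesis by (simp add: avg_def prod_dividef)
qed

lemma influence_eq: "influence n f i = avg n (\<lambda>x. if f x \<noteq> f (flip i x) then 1 else 0)"
  by (simp add: influence_def unif_def measure_pmf_of_set card_cube avg_def sum.If_cases Int_def)

text \<open>Expanding the product over \<open>l\<close> chooses \<open>b l\<close> for
  \<open>l\<close> in \<open>S\<close> and \<open>a l\<close> otherwise. So every product-form
  Fourier multiplier is averaging against a product kernel; \<open>a = b = 1\<close> gives
  inversion, another choice gives \<open>dcoef\<close>.\<close>

lemma sum_multiplier: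
  "(\<Sum>S\<in>Pow {1..n}. (\<Prod>l\<in>S. b l) * (\<Prod>l\<in>{1..n}-S. a l) * fcoef n f S * chi S x)
   = avg n (\<lambda>z. f z * (\<Prod>l\<in>{1..n}. a l + b l * (sg x l * sg z l)))"
proof -
  have *: "(\<Prod>l\<in>{1..n}. a l + b l * (sg x l * sg z l))
      = (\<Sum>S\<in>Pow {1..n}. (\<Prod>l\<in>S. b l) * (\<Prod>l\<in>{1..n}-S. a l) * (chi S x * chi S z))" for z
  proof -
    have "(\<Prod>l\<in>{1..n}. a l + b l * (sg x l * sg z l)) = (\<Prod>l\<in>{1..n}. b l * (sg x l * sg z l) + a l)"
      by (simp add: add.commute)
    also have "\<dots> = (\<Sum>S\<in>Pow {1..n}. (\<Prod>l\<in>S. b l * (sg x l * sg z l)) * (\<Prod>l\<in>{1..n}-S. a l))"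
      by (rule prod_add) simp
    finally show ?thesis by (simp add: prod.distrib chi_def mult_ac)
  qed
  show ?thesis
    unfolding * fcoef_def sum_distrib_left avg_sum
    by (intro sum.cong refl) (simp add: mult_ac flip: avg_cmult)
qed

lemma fourier_inversion:
  assumes "x \<in> cube n"
  shows "(\<Sum>S\<in>Pow {1..n}. fcoef n f S * chi S x) = f x"
proof -
  \<comment> \<open>The kernel for \<open>a = b = 1\<close> is a point mass at \<open>x\<close>: a
    coordinate where \<open>z\<close> and \<open>x\<close> differ contributes a factor 0.\<close>
  have delta: "(\<Prod>l\<in>{1..n}. 1 + sg x l * sg z l) = (if z = x then 2 ^ n else 0)" if z: "z \<in> cube n" for z
  proof (cases "z = x")
    case False
    then obtain l where l: "l \<in> {1..n}" "z l \<noteq> x l"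
      using False PiE_ext[OF z[unfolded cube_def] assms[unfolded cube_def]] by blast
    then have "1 + sg x l * sg z l = 0"
      using cube_cases[OF assms l(1)] cube_cases[OF z l(1)] by (auto simp: sg_def)
    then show ?thesis using l False by (auto intro!: prod_zero)
  qed simp
  have "(\<Sum>S\<in>Pow {1..n}. fcoef n f S * chi S x) = avg n (\<lambda>z. f z * (\<Prod>l\<in>{1..n}. 1 + sg x l * sg z l))"
    using sum_multiplier[where a="\<lambda>_. 1" and b="\<lambda>_. 1" and n=n and f=f and x=x] by simp
  also have "\<dots> = avg n (\<lambda>z. if z = x then f x * 2 ^ n else 0)"
    by (rule avg_cong) (simp only: delta, simp)
  also have "\<dots> = f x" using assms by (simp add: avg_def)
  finally show ?thesis .
qed

lemma parseval: "avg n (\<lambda>x. (f x)\<^sup>2) = (\<Sum>S\<in>Pow {1..n}. (fcoef n f S)\<^sup>2)"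
proof -
  have "avg n (\<lambda>x. (f x)\<^sup>2) = avg n (\<lambda>x. \<Sum>S\<in>Pow {1..n}. fcoef n f S * (f x * chi S x))"
  proof (rule avg_cong)
    fix x assume "x \<in> cube n"
    then have "(f x)\<^sup>2 = f x * (\<Sum>S\<in>Pow {1..n}. fcoef n f S * chi S x)"
      by (simp only: fourier_inversion power2_eq_square)
    then show "(f x)\<^sup>2 = (\<Sum>S\<in>Pow {1..n}. fcoef n f S * (f x * chi S x))"
      by (simp add: sum_distrib_left mult_ac)
  qed
  then show ?thesis by (simp add: avg_sum avg_cmult fcoef_def power2_eq_square)
qed

lemma variance_fourier: "var n f = (\<Sum>S\<in>Pow {1..n} - {{}}. (fcoef n f S)\<^sup>2)"
  by (simp add: var_def expectation_unif parseval sum_diff1 fcoef_def[of n f "{}"] chi_def)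

text \<open>Pairing \<open>x\<close> with \<open>flip i x\<close> leaves
  \<open>(f x - f (flip i x)) * g x\<close>, which vanishes unless \<open>i\<close> is sensitive at
  \<open>x\<close> and is at most \<open>\<bar>g x\<bar>\<close> otherwise.\<close>

lemma odd_correlation:
  assumes i: "i \<in> {1..n}" and f: "f \<in> cube n \<rightarrow> {0, 1}"
    and odd: "\<And>x. x \<in> cube n \<Longrightarrow> g (flip i x) = - g x"
  shows "avg n (\<lambda>x. f x * g x) \<le> avg n (\<lambda>x. if f x \<noteq> f (flip i x) then \<bar>g x\<bar> else 0) / 2"
proof -
  have "avg n (\<lambda>x. f x * g x) = (avg n (\<lambda>x. f x * g x) + avg n (\<lambda>x. f (flip i x) * g (flip i x))) / 2"
    using avg_flip[OF i, of "\<lambda>x. f x * g x"] by simp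
  also have "\<dots> \<le> avg n (\<lambda>x. if f x \<noteq> f (flip i x) then \<bar>g x\<bar> else 0) / 2"
    unfolding avg_add[symmetric]
  proof (intro divide_right_mono avg_mono)
    fix x assume x: "x \<in> cube n"
    then have "f x \<in> {0,1}" "f (flip i x) \<in> {0,1}" using f flip_in_cube[OF x i] by auto
    then show "f x * g x + f (flip i x) * g (flip i x) \<le> (if f x \<noteq> f (flip i x) then \<bar>g x\<bar> else 0)"
      using odd[OF x] by auto
  qed simp
  finally show ?thesis .
qed

section \<open>Decay of the Fourier tail\<close>

text \<open>Up to the sign \<open>sg x i\<close>, the \<open>i\<close>-th partial derivative of the multilinear extension of \<open>f\<close>
  at \<open>\<rho> x\<close>.\<close>

definition dcoef :: "nat \<Rightarrow> ((nat \<Rightarrow> nat) \<Rightarrow> real) \<Rightarrow> real \<Rightarrow> nat \<Rightarrow> (nat \<Rightarrow> nat) \<Rightarrow> real" where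
  "dcoef n f \<rho> i x = (\<Sum>S\<in>{S\<in>Pow {1..n}. i \<in> S}. \<rho> ^ (card S - 1) * fcoef n f S * chi S x)"

lemma dcoef_eq:
  assumes i: "i \<in> {1..n}"
  shows "dcoef n f \<rho> i x = avg n (\<lambda>z. f z * (\<Prod>l\<in>{1..n}.
    if l = i then sg x l * sg z l else 1 + \<rho> * (sg x l * sg z l)))"
proof -
  \<comment> \<open>\<open>?a i = 0\<close> removes the sets that miss \<open>i\<close>, and
    \<open>?b i = 1\<close> drops one factor \<rho>, which produces the exponent
    \<open>card S - 1\<close>.\<close>
  let ?a = "\<lambda>l. if l = i then 0 else (1::real)" and ?b = "\<lambda>l. if l = i then 1 else \<rho>"
  have "(\<Prod>l\<in>S. ?b l) * (\<Prod>l\<in>{1..n}-S. ?a l) = (if i \<in> S then \<rho> ^ (card S - 1) else 0)"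
    if S: "S \<in> Pow {1..n}" for S
  proof (cases "i \<in> S")
    case True
    have fin: "finite S" using S finite_subset by auto
    have "(\<Prod>l\<in>S. ?b l) = (\<Prod>l\<in>S - {i}. \<rho>)"
      using True fin by (subst prod.remove[of S i]) (auto intro!: prod.cong)
    moreover have "(\<Prod>l\<in>{1..n}-S. ?a l) = 1" using True by (intro prod.neutral) auto
    ultimately show ?thesis using True fin by simp
  next
    case False
    then have "(\<Prod>l\<in>{1..n}-S. ?a l) = 0" using i by (intro prod_zero) auto
    then show ?thesis using False by simp
  qed
  then have "(\<Sum>S\<in>Pow {1..n}. (\<Prod>l\<in>S. ?b l) * (\<Prod>l\<in>{1..n}-S. ?a l) * fcoef n f S * chi S x)
    = (\<Sum>S\<in>Pow {1..n}. if i \<in> S then \<rho> ^ (card S - 1) * fcoef n f S * chi S x else 0)"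
    by (intro sum.cong refl) simp
  also have "\<dots> = dcoef n f \<rho> i x"
    unfolding dcoef_def by (rule sum.inter_filter[symmetric]) simp
  finally have "dcoef n f \<rho> i x = avg n (\<lambda>z. f z * (\<Prod>l\<in>{1..n}. ?a l + ?b l * (sg x l * sg z l)))"
    by (simp only: sum_multiplier)
  also have "\<dots> = avg n (\<lambda>z. f z * (\<Prod>l\<in>{1..n}. if l = i then sg x l * sg z l else 1 + \<rho> * (sg x l * sg z l)))"
    by (intro avg_cong arg_cong2[where f="(*)"] prod.cong refl) simp
  finally show ?thesis .
qed

text \<open>Multiplying a uniform sign by the fixed sign \<open>sg x l\<close> leaves it uniform, so
  the average does not depend on \<open>x\<close>.\<close>

lemma avg_prod_sg:
  "avg n (\<lambda>z. \<Prod>l\<in>{1..n}. \<phi> l (sg x l * sg z l)) = (\<Prod>l\<in>{1..n}. (\<phi> l 1 + \<phi> l (-1)) / 2)"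
proof -
  have "avg n (\<lambda>z. \<Prod>l\<in>{1..n}. \<phi> l (sg x l * sg z l))
      = (\<Prod>l\<in>{1..n}. (\<phi> l (sg x l * 1) + \<phi> l (sg x l * (-1))) / 2)"
    using avg_prod[where \<phi>="\<lambda>l v. \<phi> l (sg x l * (-1) ^ v)" and n=n] by (simp add: sg_def)
  also have "\<dots> = (\<Prod>l\<in>{1..n}. (\<phi> l 1 + \<phi> l (-1)) / 2)"
  proof (intro prod.cong refl)
    fix l
    have "sg x l = 1 \<or> sg x l = -1" using abs_sg[of x l] by linarith
    then show "(\<phi> l (sg x l * 1) + \<phi> l (sg x l * (-1))) / 2 = (\<phi> l 1 + \<phi> l (-1)) / 2" by auto
  qed
  finally show ?thesis .
qed

lemma sg_mult_cases: "sg x l * sg z l = 1 \<or> sg x l * sg z l = -1"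
proof -
  have "sg y l = 1 \<or> sg y l = -1" for y using abs_sg[of y l] by linarith
  from this[of x] this[of z] show ?thesis by auto
qed

text \<open>In absolute value the \<open>i\<close>-th factor of the kernel becomes 1 and the others
  stay nonnegative, so the kernel is dominated by a probability density.\<close>

lemma abs_dcoef_le:
  assumes i: "i \<in> {1..n}" and f: "f \<in> cube n \<rightarrow> {0, 1}" and \<rho>: "0 \<le> \<rho>" "\<rho> \<le> 1"
  shows "\<bar>dcoef n f \<rho> i x\<bar> \<le> 1"
proof -
  let ?t = "\<lambda>z l. sg x l * sg z l"
  have "\<bar>dcoef n f \<rho> i x\<bar> \<le> avg n (\<lambda>z. \<bar>f z * (\<Prod>l\<in>{1..n}. if l = i then ?t z l else 1 + \<rho> * ?t z l)\<bar>)"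
    unfolding dcoef_eq[OF i] by (rule abs_avg_le)
  also have "\<dots> \<le> avg n (\<lambda>z. \<Prod>l\<in>{1..n}. if l = i then 1 else 1 + \<rho> * ?t z l)"
  proof (rule avg_mono)
    fix z assume "z \<in> cube n"
    then have fz: "\<bar>f z\<bar> \<le> 1" using f by (auto simp: Pi_def)
    have "0 \<le> 1 + \<rho> * ?t z l" for l using sg_mult_cases[of x l z] \<rho> by auto
    then have prod: "\<bar>\<Prod>l\<in>{1..n}. if l = i then ?t z l else 1 + \<rho> * ?t z l\<bar>
       = (\<Prod>l\<in>{1..n}. if l = i then 1 else 1 + \<rho> * ?t z l)"
      unfolding abs_prod by (intro prod.cong refl) (simp add: abs_mult abs_of_nonneg del: abs_mult_self)
    have "\<bar>f z * c\<bar> \<le> \<bar>c\<bar>" for c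
      using mult_right_mono[OF fz abs_ge_zero] by (simp only: abs_mult mult_1)
    then show "\<bar>f z * (\<Prod>l\<in>{1..n}. if l = i then ?t z l else 1 + \<rho> * ?t z l)\<bar>
       \<le> (\<Prod>l\<in>{1..n}. if l = i then 1 else 1 + \<rho> * ?t z l)"
      unfolding prod[symmetric] .
  qed
  also have "\<dots> = 1"
    by (subst avg_prod_sg[where \<phi>="\<lambda>l t. if l = i then 1 else 1 + \<rho> * t"]) (auto intro!: prod.neutral)
  finally show ?thesis .
qed

text \<open>Under the \<open>\<rho>\<close>-biased measure with density \<open>K\<close> around \<open>x\<close>, the functions \<open>t\<^sub>i - \<rho>\<close> are
  orthogonal with squared norm \<open>1 - \<rho>\<^sup>2\<close>, and \<open>dcoef n f \<rho> i x\<close> are the coefficients of \<open>f\<close>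
  along them.\<close>

lemma dcoef_bessel:
  assumes f: "f \<in> cube n \<rightarrow> {0, 1}" and \<rho>: "0 \<le> \<rho>" "\<rho> < 1"
  shows "(\<Sum>i\<in>{1..n}. (dcoef n f \<rho> i x)\<^sup>2) \<le> 1 / (1 - \<rho>\<^sup>2)"
proof -
  define t where "t z l = sg x l * sg z l" for z l
  define K where "K z = (\<Prod>l\<in>{1..n}. 1 + \<rho> * t z l)" for z
  define G where "G i = dcoef n f \<rho> i x" for i
  define B where "B = (\<Sum>i\<in>{1..n}. (G i)\<^sup>2)"
  have tsq: "t z l * t z l = 1" for z l using sg_mult_cases[of x l z] by (auto simp: t_def)
  have K0: "0 \<le> K z" for z
  proof -
    have "0 \<le> 1 + \<rho> * t z l" for l using sg_mult_cases[of x l z] \<rho> by (auto simp: t_def)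
    then show ?thesis unfolding K_def by (intro prod_nonneg) auto
  qed
  have K1: "avg n K = 1"
    unfolding K_def t_def by (subst avg_prod_sg[where \<phi>="\<lambda>l t. 1 + \<rho> * t"]) simp
  \<comment> \<open>As \<open>t z i\<close> squares to 1,
    \<open>(1 - \<rho>\<^sup>2) * t z i\<close> factors as
    \<open>(1 + \<rho> * t z i) * (t z i - \<rho>)\<close>, which restores the missing factor of
    \<open>K\<close>.\<close>
  have G: "(1 - \<rho>\<^sup>2) * G i = avg n (\<lambda>z. K z * f z * (t z i - \<rho>))" if i: "i \<in> {1..n}" for i
    unfolding G_def dcoef_eq[OF i] avg_cmult[symmetric]
  proof (rule avg_cong)
    fix z
    have "(1 - \<rho>\<^sup>2) * t z i = (1 + \<rho> * t z i) * (t z i - \<rho>)"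
      using tsq[of z i] by (simp add: algebra_simps power2_eq_square)
    moreover have "(\<Prod>l\<in>{1..n}. if l = i then t z l else 1 + \<rho> * t z l) = t z i * (\<Prod>l\<in>{1..n}-{i}. 1 + \<rho> * t z l)"
      using i by (subst prod.remove[of _ i]) (auto intro!: prod.cong)
    moreover have "K z = (1 + \<rho> * t z i) * (\<Prod>l\<in>{1..n}-{i}. 1 + \<rho> * t z l)"
      unfolding K_def using i by (subst prod.remove[of _ i]) auto
    ultimately show "(1 - \<rho>\<^sup>2) * (f z * (\<Prod>l\<in>{1..n}. if l = i then sg x l * sg z l else 1 + \<rho> * (sg x l * sg z l)))
      = K z * f z * (t z i - \<rho>)"
      unfolding t_def[symmetric] by (simp add: mult_ac)
  qed
  have orth: "avg n (\<lambda>z. K z * ((t z i - \<rho>) * (t z j - \<rho>))) = (if i = j then 1 - \<rho>\<^sup>2 else 0)"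
    if i: "i \<in> {1..n}" and j: "j \<in> {1..n}" for i j
  proof -
    let ?\<phi> = "\<lambda>l s. (1 + \<rho> * s) * ((if l = i then s - \<rho> else 1) * (if l = j then s - \<rho> else 1))"
    have *: "(t z i - \<rho>) * (t z j - \<rho>) = (\<Prod>l\<in>{1..n}. (if l = i then t z l - \<rho> else 1) * (if l = j then t z l - \<rho> else 1))" for z
      using i j by (simp add: prod.distrib prod.delta)
    have "avg n (\<lambda>z. K z * ((t z i - \<rho>) * (t z j - \<rho>))) = avg n (\<lambda>z. \<Prod>l\<in>{1..n}. ?\<phi> l (sg x l * sg z l))"
      unfolding K_def * prod.distrib[symmetric] unfolding t_def ..
    also have "\<dots> = (\<Prod>l\<in>{1..n}. (?\<phi> l 1 + ?\<phi> l (-1)) / 2)" by (rule avg_prod_sg)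
    also have "\<dots> = (if i = j then 1 - \<rho>\<^sup>2 else 0)"
    proof (cases "i = j")
      case True
      then have "(\<Prod>l\<in>{1..n}. (?\<phi> l 1 + ?\<phi> l (-1)) / 2) = (\<Prod>l\<in>{1..n}. if l = i then 1 - \<rho>\<^sup>2 else 1)"
        by (intro prod.cong refl) (auto simp: algebra_simps power2_eq_square)
      then show ?thesis using True i by (simp add: prod.delta)
    next
      case False
      have "(?\<phi> i 1 + ?\<phi> i (-1)) / 2 = 0" using False by (simp add: algebra_simps)
      then show ?thesis using False i by (subst prod_zero[OF _ bexI[of _ i]]) simp_all
    qed
    finally show ?thesis .
  qed
  \<comment> \<open>Bessel's inequality comes from expanding the nonnegative
    \<open>K\<close>-weighted squared error of approximating \<open>f\<close> by its
    projection.\<close>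
  have "0 \<le> avg n (\<lambda>z. K z * (f z - (\<Sum>i\<in>{1..n}. G i * (t z i - \<rho>)))\<^sup>2)"
    by (intro avg_nonneg mult_nonneg_nonneg K0) simp
  also have "\<dots> = avg n (\<lambda>z. K z * (f z)\<^sup>2 - 2 * (\<Sum>i\<in>{1..n}. G i * (K z * f z * (t z i - \<rho>)))
      + (\<Sum>i\<in>{1..n}. G i * (\<Sum>j\<in>{1..n}. G j * (K z * ((t z i - \<rho>) * (t z j - \<rho>))))))"
  proof (rule avg_cong)
    fix z
    have "(\<Sum>i\<in>{1..n}. G i * (\<Sum>j\<in>{1..n}. G j * (K z * ((t z i - \<rho>) * (t z j - \<rho>)))))
      = K z * (\<Sum>i\<in>{1..n}. G i * (t z i - \<rho>))\<^sup>2"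
      unfolding power2_eq_square sum_product unfolding sum_distrib_left
      by (intro sum.cong refl) (simp add: mult_ac)
    moreover have "(\<Sum>i\<in>{1..n}. G i * (K z * f z * (t z i - \<rho>))) = K z * f z * (\<Sum>i\<in>{1..n}. G i * (t z i - \<rho>))"
      unfolding sum_distrib_left by (intro sum.cong refl) (simp add: mult_ac)
    ultimately show "K z * (f z - (\<Sum>i\<in>{1..n}. G i * (t z i - \<rho>)))\<^sup>2 =
      K z * (f z)\<^sup>2 - 2 * (\<Sum>i\<in>{1..n}. G i * (K z * f z * (t z i - \<rho>)))
      + (\<Sum>i\<in>{1..n}. G i * (\<Sum>j\<in>{1..n}. G j * (K z * ((t z i - \<rho>) * (t z j - \<rho>)))))"
      by (simp add: power2_diff algebra_simps)
  qed
  also have "\<dots> = avg n (\<lambda>z. K z * (f z)\<^sup>2) - 2 * (\<Sum>i\<in>{1..n}. G i * ((1 - \<rho>\<^sup>2) * G i))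
      + (\<Sum>i\<in>{1..n}. G i * (\<Sum>j\<in>{1..n}. G j * (if i = j then 1 - \<rho>\<^sup>2 else 0)))"
    unfolding avg_add avg_diff avg_cmult avg_sum
    by (intro arg_cong2[where f="(+)"] arg_cong2[where f="(-)"] arg_cong2[where f="(*)"] sum.cong refl)
       (simp_all only: G orth)
  also have "(\<Sum>i\<in>{1..n}. G i * (\<Sum>j\<in>{1..n}. G j * (if i = j then 1 - \<rho>\<^sup>2 else 0))) = (1 - \<rho>\<^sup>2) * B"
    unfolding B_def sum_distrib_left
    by (intro sum.cong refl) (simp add: if_distrib[of "(*) _"] sum.delta power2_eq_square cong: if_cong)
  also have "(\<Sum>i\<in>{1..n}. G i * ((1 - \<rho>\<^sup>2) * G i)) = (1 - \<rho>\<^sup>2) * B"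
    unfolding B_def sum_distrib_left by (intro sum.cong refl) (simp add: power2_eq_square)
  finally have "(1 - \<rho>\<^sup>2) * B \<le> avg n (\<lambda>z. K z * (f z)\<^sup>2)" by (simp add: mult.commute)
  also have "\<dots> \<le> avg n K"
  proof (rule avg_mono)
    fix z assume "z \<in> cube n"
    then have "(f z)\<^sup>2 \<le> 1" using f by (auto simp: Pi_def)
    then show "K z * (f z)\<^sup>2 \<le> K z" using K0 by (intro mult_left_le)
  qed
  finally have "(1 - \<rho>\<^sup>2) * B \<le> 1" using K1 by simp
  moreover have "0 < 1 - \<rho>\<^sup>2" using \<rho> by (simp add: power_less_one_iff abs_square_less_1)
  ultimately show ?thesis by (simp add: B_def G_def field_simps)
qed

lemma avg_mult_dcoef:
  "avg n (\<lambda>x. f x * dcoef n f \<rho> i x) = (\<Sum>S\<in>{S\<in>Pow {1..n}. i \<in> S}. \<rho> ^ (card S - 1) * (fcoef n f S)\<^sup>2)"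
proof -
  have "avg n (\<lambda>x. f x * dcoef n f \<rho> i x)
    = avg n (\<lambda>x. \<Sum>S\<in>{S\<in>Pow {1..n}. i \<in> S}. \<rho> ^ (card S - 1) * fcoef n f S * (f x * chi S x))"
    by (simp add: dcoef_def sum_distrib_left mult_ac)
  also have "\<dots> = (\<Sum>S\<in>{S\<in>Pow {1..n}. i \<in> S}. \<rho> ^ (card S - 1) * fcoef n f S * fcoef n f S)"
    by (simp only: avg_sum avg_cmult fcoef_def)
  finally show ?thesis by (simp add: power2_eq_square mult_ac)
qed

lemma sum_over_elements:
  fixes g :: "nat set \<Rightarrow> real"
  shows "(\<Sum>i\<in>{1..n}. \<Sum>S\<in>{S\<in>Pow {1..n}. i \<in> S}. g S) = (\<Sum>S\<in>Pow {1..n}. real (card S) * g S)"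
proof -
  have "(\<Sum>i\<in>{1..n}. \<Sum>S\<in>{S\<in>Pow {1..n}. i \<in> S}. g S) = (\<Sum>i\<in>{1..n}. \<Sum>S\<in>Pow {1..n}. if i \<in> S then g S else 0)"
    by (intro sum.cong refl sum.inter_filter) simp
  also have "\<dots> = (\<Sum>S\<in>Pow {1..n}. \<Sum>i\<in>{1..n}. if i \<in> S then g S else 0)"
    by (rule sum.swap)
  also have "\<dots> = (\<Sum>S\<in>Pow {1..n}. real (card S) * g S)"
  proof (intro sum.cong refl)
    fix S assume "S \<in> Pow {1..n}"
    then have "{i\<in>{1..n}. i \<in> S} = S" by auto
    then show "(\<Sum>i\<in>{1..n}. if i \<in> S then g S else 0) = real (card S) * g S"
      by (simp add: sum.inter_filter[symmetric])
  qed
  finally show ?thesis .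
qed

lemma dcoef_flip:
  assumes "x \<in> cube n" "i \<in> {1..n}"
  shows "dcoef n f \<rho> i (flip i x) = - dcoef n f \<rho> i x"
  unfolding dcoef_def sum_negf[symmetric]
proof (intro sum.cong refl)
  fix S assume "S \<in> {S\<in>Pow {1..n}. i \<in> S}"
  then have "chi S (flip i x) = - chi S x"
    using assms by (intro chi_flip_in) (auto intro: finite_subset)
  then show "\<rho> ^ (card S - 1) * fcoef n f S * chi S (flip i x) = - (\<rho> ^ (card S - 1) * fcoef n f S * chi S x)"
    by simp
qed

text \<open>The left side is the derivative of the noise stability at \<rho>. Oddness of
  \<open>dcoef\<close> restricts the sum to sensitive coordinates, where Hoelder combines Bessel's
  bound with their number.\<close>

lemma stability_deriv_le:
  assumes f: "f \<in> cube n \<rightarrow> {0, 1}" and \<rho>: "0 \<le> \<rho>" "\<rho> < 1" and p: "1/2 \<le> p" "p \<le> 1"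
    and A: "avg n (\<lambda>x. real (sensitivity n f x) powr p) \<le> A"
  shows "(\<Sum>S\<in>Pow {1..n}. real (card S) * (\<rho> ^ (card S - 1) * (fcoef n f S)\<^sup>2))
     \<le> A / 2 * (1 - \<rho>) powr (p - 1)"
proof -
  let ?V = "\<lambda>x. {i\<in>{1..n}. f (flip i x) \<noteq> f x}"
  have "(\<Sum>S\<in>Pow {1..n}. real (card S) * (\<rho> ^ (card S - 1) * (fcoef n f S)\<^sup>2))
     = (\<Sum>i\<in>{1..n}. avg n (\<lambda>x. f x * dcoef n f \<rho> i x))"
    unfolding avg_mult_dcoef sum_over_elements ..
  also have "\<dots> \<le> (\<Sum>i\<in>{1..n}. avg n (\<lambda>x. if f x \<noteq> f (flip i x) then \<bar>dcoef n f \<rho> i x\<bar> else 0) / 2)"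
    by (intro sum_mono odd_correlation f dcoef_flip)
  also have "\<dots> = avg n (\<lambda>x. \<Sum>i\<in>?V x. \<bar>dcoef n f \<rho> i x\<bar>) / 2"
    unfolding sum_divide_distrib[symmetric] avg_sum[symmetric]
    by (intro arg_cong2[where f="(/)"] avg_cong refl) (subst sum.inter_filter, auto intro!: sum.cong)
  also have "\<dots> \<le> avg n (\<lambda>x. (1 - \<rho>) powr (p - 1) * real (sensitivity n f x) powr p) / 2"
  proof (intro divide_right_mono avg_mono)
    fix x assume "x \<in> cube n"
    let ?g = "\<lambda>i. (dcoef n f \<rho> i x)\<^sup>2"
    have "(\<Sum>i\<in>?V x. \<bar>dcoef n f \<rho> i x\<bar>) \<le> (\<Sum>i\<in>?V x. ?g i powr (1 - p))"
    proof (rule sum_mono)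
      fix i assume "i \<in> ?V x"
      then have le: "\<bar>dcoef n f \<rho> i x\<bar> \<le> 1" using abs_dcoef_le[OF _ f] \<rho> by auto
      show "\<bar>dcoef n f \<rho> i x\<bar> \<le> ?g i powr (1 - p)"
      proof (cases "dcoef n f \<rho> i x = 0")
        case False
        have "?g i powr (1 - p) = \<bar>dcoef n f \<rho> i x\<bar> powr (2 * (1 - p))"
          using False by (subst powr_powr[symmetric]) simp
        \<comment> \<open>Here \<open>p \<ge> 1/2\<close> enters: the exponent
          \<open>2 * (1 - p)\<close> is at most 1 and the base is at most 1.\<close>
        also have "\<dots> \<ge> \<bar>dcoef n f \<rho> i x\<bar> powr 1" using False le p by (intro powr_mono') auto
        finally show ?thesis using False by simp
      qed simp
    qed
    also have "\<dots> \<le> (1 / (1 - \<rho>\<^sup>2)) powr (1 - p) * real (card (?V x)) powr p"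
    proof (rule sum_powr_le)
      show "(\<Sum>i\<in>?V x. ?g i) \<le> 1 / (1 - \<rho>\<^sup>2)"
        by (rule order_trans[OF sum_mono2 dcoef_bessel[OF f \<rho>, of x]]) auto
    qed (use p in auto)
    also have "\<dots> \<le> (1 / (1 - \<rho>)) powr (1 - p) * real (card (?V x)) powr p"
    proof (intro mult_right_mono powr_mono2)
      have "\<rho>\<^sup>2 \<le> \<rho>" using \<rho> by (simp add: power2_eq_square mult_left_le)
      then show "1 / (1 - \<rho>\<^sup>2) \<le> 1 / (1 - \<rho>)" "0 \<le> 1 / (1 - \<rho>\<^sup>2)" using \<rho> by (auto intro: divide_left_mono)
    qed (use p in auto)
    also have "(1 / (1 - \<rho>)) powr (1 - p) = (1 - \<rho>) powr (p - 1)"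
      using \<rho> powr_minus_divide[of "1 - \<rho>" "1 - p"] by (simp add: powr_divide)
    finally show "(\<Sum>i\<in>?V x. \<bar>dcoef n f \<rho> i x\<bar>) \<le> (1 - \<rho>) powr (p - 1) * real (sensitivity n f x) powr p"
      by (simp add: sensitivity_def)
  qed simp
  also have "\<dots> \<le> A / 2 * (1 - \<rho>) powr (p - 1)"
    using mult_left_mono[OF A, of "(1 - \<rho>) powr (p - 1)"] by (simp add: avg_cmult mult_ac)
  finally show ?thesis .
qed

lemma stability_diff_le:
  assumes f: "f \<in> cube n \<rightarrow> {0, 1}" and r: "0 \<le> r" "r \<le> 1" and p: "1/2 \<le> p" "p \<le> 1"
    and A: "avg n (\<lambda>x. real (sensitivity n f x) powr p) \<le> A"
  shows "(\<Sum>S\<in>Pow {1..n}. (1 - r ^ card S) * (fcoef n f S)\<^sup>2) \<le> A * (1 - r) powr p"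
proof -
  define F where "F r = (\<Sum>S\<in>Pow {1..n}. r ^ card S * (fcoef n f S)\<^sup>2)" for r :: real
  \<comment> \<open>The added term is chosen so that its derivative cancels the bound of
    \<open>stability_deriv_le\<close>, making \<open>H\<close> nonincreasing.\<close>
  define H where "H r = F r + A / (2 * p) * (1 - r) powr p" for r
  have A0: "0 \<le> A" using A avg_nonneg[of n "\<lambda>x. real (sensitivity n f x) powr p"] by simp
  \<comment> \<open>For \<open>p < 1\<close> the derivative of the power is singular at 1, so
    derivatives are taken on the open interval only, with continuity at the ends.\<close>
  have "H r \<ge> H 1"
  proof (rule DERIV_nonpos_imp_decreasing_open[OF r(2)])
    fix \<rho> assume \<rho>: "r < \<rho>" "\<rho> < 1"
    let ?D = "(\<Sum>S\<in>Pow {1..n}. real (card S) * (\<rho> ^ (card S - 1) * (fcoef n f S)\<^sup>2))"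
    have "(F has_real_derivative ?D) (at \<rho>)"
      unfolding F_def by (auto intro!: derivative_eq_intros sum.cong)
    moreover have "((\<lambda>r. A / (2 * p) * (1 - r) powr p) has_real_derivative - (A / 2 * (1 - \<rho>) powr (p - 1))) (at \<rho>)"
      using \<rho> p by (auto intro!: derivative_eq_intros simp: powr_diff field_simps)
    ultimately have "(H has_real_derivative ?D + - (A / 2 * (1 - \<rho>) powr (p - 1))) (at \<rho>)"
      unfolding H_def by (rule DERIV_add)
    moreover have "?D + - (A / 2 * (1 - \<rho>) powr (p - 1)) \<le> 0"
      using stability_deriv_le[OF f _ _ p A, of \<rho>] \<rho> r by simp
    ultimately show "\<exists>y. DERIV H \<rho> :> y \<and> y \<le> 0" by blast
  next
    show "continuous_on {r..1} H"
      unfolding H_def F_def using p by (intro continuous_intros continuous_on_powr') auto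
  qed
  then have "F 1 - F r \<le> A / (2 * p) * (1 - r) powr p" by (simp add: H_def)
  also have "\<dots> \<le> A * (1 - r) powr p"
    using p mult_left_mono[of 1 "2 * p" A] A0 by (intro mult_right_mono) (auto simp: field_simps)
  finally show ?thesis
    by (simp add: F_def sum_subtractf algebra_simps)
qed

section \<open>Hypercontractivity\<close>

text \<open>The even and odd parts \<open>E\<close> and \<open>D\<close> satisfy a coupled
  recursion, \<open>E + u * D\<close> and \<open>D + u * E\<close>, so both bounds must be carried
  through one induction.\<close>

lemma even_part_le:
  fixes u :: real
  assumes "\<bar>u\<bar> \<le> 1"
  shows "((1 + u) ^ k + (1 - u) ^ k) / 2 \<le> 1 + 2 ^ k * u\<^sup>2
    \<and> \<bar>((1 + u) ^ k - (1 - u) ^ k) / 2\<bar> \<le> 2 ^ k * \<bar>u\<bar>"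
proof (induction k)
  case (Suc k)
  define E where "E = ((1 + u) ^ k + (1 - u) ^ k) / 2"
  define D where "D = ((1 + u) ^ k - (1 - u) ^ k) / 2"
  have IH: "E \<le> 1 + 2 ^ k * u\<^sup>2" "\<bar>D\<bar> \<le> 2 ^ k * \<bar>u\<bar>" using Suc by (auto simp: E_def D_def)
  have "(1 + u) ^ k \<le> 2 ^ k" "(1 - u) ^ k \<le> 2 ^ k" "0 \<le> (1 + u) ^ k" "0 \<le> (1 - u) ^ k"
    using assms by (auto intro!: power_mono)
  then have E: "\<bar>E\<bar> \<le> 2 ^ k" by (simp add: E_def)
  have calc: "((1 + u) ^ Suc k + (1 - u) ^ Suc k) / 2 = E + u * D"
    "((1 + u) ^ Suc k - (1 - u) ^ Suc k) / 2 = D + u * E"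
    by (simp_all add: E_def D_def field_simps)
  have "u * D \<le> \<bar>u\<bar> * \<bar>D\<bar>" by (metis abs_ge_self abs_mult)
  moreover have "\<bar>u\<bar> * \<bar>D\<bar> \<le> \<bar>u\<bar> * (2 ^ k * \<bar>u\<bar>)" using IH by (intro mult_left_mono) auto
  moreover have "\<bar>u\<bar> * (2 ^ k * \<bar>u\<bar>) = 2 ^ k * u\<^sup>2" by (simp add: power2_eq_square)
  moreover have "\<bar>D + u * E\<bar> \<le> \<bar>D\<bar> + \<bar>u\<bar> * \<bar>E\<bar>" by (metis abs_mult abs_triangle_ineq)
  moreover have "\<bar>u\<bar> * \<bar>E\<bar> \<le> \<bar>u\<bar> * 2 ^ k" using E by (intro mult_left_mono) auto
  ultimately show ?case
    unfolding calc using IH by (simp only: power_Suc) (auto simp: algebra_simps)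
qed simp

text \<open>The one-variable case of hypercontractivity. \<open>P\<close> and \<open>H\<close> stand
  for the squared norms of the parts without and with the variable, \<open>X\<close> for their inner
  product; the two powers belong to the two signs.\<close>

lemma two_point:
  fixes P H X \<rho> :: real
  assumes P: "0 \<le> P" and H: "0 \<le> H" and X: "X\<^sup>2 \<le> P * H" and \<rho>: "0 \<le> \<rho>" "\<rho>\<^sup>2 * (1 + 4 * 2 ^ k) = 1"
    and k: "k > 0"
  shows "((P + \<rho>\<^sup>2 * H + 2 * \<rho> * X) ^ k + (P + \<rho>\<^sup>2 * H - 2 * \<rho> * X) ^ k) / 2 \<le> (P + H) ^ k"
proof -
  define a where "a = P + \<rho>\<^sup>2 * H"
  define b where "b = 2 * \<rho> * X"
  have \<rho>0: "\<rho>\<^sup>2 > 0" using \<rho>(2) by (metis less_eq_real_def mult_zero_left zero_le_power2 zero_neq_one)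
  have bsq: "b\<^sup>2 \<le> 4 * \<rho>\<^sup>2 * (P * H)" using mult_left_mono[OF X, of "4 * \<rho>\<^sup>2"] by (simp add: b_def power2_eq_square mult_ac)
  have a0: "0 \<le> a" using P H by (simp add: a_def)
  show ?thesis
  proof (cases "a = 0")
    case True
    then have "P = 0" "H = 0" using P H \<rho>0 unfolding a_def by (smt (verit) mult_pos_pos mult_nonneg_nonneg)+
    then show ?thesis using X by simp
  next
    case False
    define u where "u = b / a"
    \<comment> \<open>AM-GM gives \<open>\<bar>b\<bar> \<le> a\<close>, so
      \<open>even_part_le\<close> applies to the ratio \<open>u\<close>.\<close>
    have "a\<^sup>2 - 4 * \<rho>\<^sup>2 * (P * H) = (P - \<rho>\<^sup>2 * H)\<^sup>2" by (simp add: a_def power2_eq_square algebra_simps)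
    then have "b\<^sup>2 \<le> a\<^sup>2" using bsq zero_le_power2[of "P - \<rho>\<^sup>2 * H"] by linarith
    then have "\<bar>b\<bar> \<le> a" using a0 abs_le_square_iff[of b a] by simp
    then have u: "\<bar>u\<bar> \<le> 1" using a0 False by (simp add: u_def)
    have b: "b = a * u" using False by (simp add: u_def)
    have "a * u\<^sup>2 = b\<^sup>2 / a" using False by (simp add: u_def power2_eq_square)
    also have "\<dots> \<le> 4 * \<rho>\<^sup>2 * H"
    proof -
      have "4 * \<rho>\<^sup>2 * (P * H) \<le> 4 * \<rho>\<^sup>2 * H * a"
        using mult_left_mono[of P a "4 * \<rho>\<^sup>2 * H"] H by (simp add: a_def mult_ac)
      then show ?thesis using bsq a0 False by (simp add: divide_le_eq)
    qed
    finally have au: "a * u\<^sup>2 \<le> 4 * \<rho>\<^sup>2 * H" .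
    have "((a + b) ^ k + (a - b) ^ k) / 2 = a ^ k * (((1 + u) ^ k + (1 - u) ^ k) / 2)"
    proof -
      have "a + b = a * (1 + u)" "a - b = a * (1 - u)" by (simp_all add: b algebra_simps)
      then show ?thesis by (simp only: power_mult_distrib) (simp add: distrib_left add_divide_distrib)
    qed
    also have "\<dots> \<le> a ^ k * (1 + 2 ^ k * u\<^sup>2)"
      using even_part_le[OF u, of k] a0 by (intro mult_left_mono) auto
    \<comment> \<open>Raising a number at least 1 to the power \<open>k\<close> is wasteful but
      turns the whole bound into a \<open>k\<close>-th power.\<close>
    also have "\<dots> \<le> a ^ k * (1 + 2 ^ k * u\<^sup>2) ^ k"
      using a0 k by (intro mult_left_mono self_le_power) auto
    also have "\<dots> = (a + 2 ^ k * (a * u\<^sup>2)) ^ k"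
      by (simp add: algebra_simps flip: power_mult_distrib)
    also have "\<dots> \<le> (P + H) ^ k"
    proof (rule power_mono)
      \<comment> \<open>The condition on \<rho> is exactly what makes the total coefficient of
        \<open>H\<close> equal to 1.\<close>
      have "a + 2 ^ k * (a * u\<^sup>2) \<le> a + 2 ^ k * (4 * \<rho>\<^sup>2 * H)" using au by simp
      also have "\<dots> = P + \<rho>\<^sup>2 * (1 + 4 * 2 ^ k) * H" by (simp add: a_def algebra_simps)
      finally show "a + 2 ^ k * (a * u\<^sup>2) \<le> P + H" using \<rho> by simp
    qed (use a0 in simp)
    finally show ?thesis by (simp add: a_def b_def)
  qed
qed

lemma sum_list_Cauchy_Schwarz:
  fixes g h :: "'a \<Rightarrow> real"
  shows "(\<Sum>c\<leftarrow>cs. g c * h c)\<^sup>2 \<le> (\<Sum>c\<leftarrow>cs. (g c)\<^sup>2) * (\<Sum>c\<leftarrow>cs. (h c)\<^sup>2)"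
  using Cauchy_Schwarz_ineq_sum[of "\<lambda>i. g (cs ! i)" "\<lambda>i. h (cs ! i)" "{0..<length cs}"]
  by (simp add: sum_list_sum_nth)

text \<open>The noise operator applied to the polynomial with coefficients \<open>c\<close> in the
  variables \<open>U\<close>. Arbitrary coefficient families are allowed so that a variable can be
  split off.\<close>

definition noisy :: "real \<Rightarrow> nat set \<Rightarrow> (nat set \<Rightarrow> real) \<Rightarrow> (nat \<Rightarrow> nat) \<Rightarrow> real" where
  "noisy \<rho> U c x = (\<Sum>S\<in>Pow U. \<rho> ^ card S * c S * chi S x)"

lemma sum_Pow_insert:
  assumes "finite U" "u \<notin> U"
  shows "(\<Sum>S\<in>Pow (insert u U). g S) = (\<Sum>S\<in>Pow U. g S) + (\<Sum>S\<in>Pow U. g (insert u S) :: real)"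
proof -
  have "inj_on (insert u) (Pow U)" using assms by (intro inj_onI) (metis PowD insert_ident subsetD)
  then show ?thesis
    unfolding Pow_insert using assms by (subst sum.union_disjoint) (auto simp: sum.reindex)
qed

lemma noisy_insert:
  assumes "finite U" "u \<notin> U"
  shows "noisy \<rho> (insert u U) c x = noisy \<rho> U c x + \<rho> * sg x u * noisy \<rho> U (\<lambda>S. c (insert u S)) x"
proof -
  have "(\<Sum>S\<in>Pow U. \<rho> ^ card (insert u S) * c (insert u S) * chi (insert u S) x)
     = (\<Sum>S\<in>Pow U. \<rho> * sg x u * (\<rho> ^ card S * c (insert u S) * chi S x))"
  proof (intro sum.cong refl)
    fix S assume "S \<in> Pow U"
    then have "finite S" "u \<notin> S" using assms by (auto intro: finite_subset)
    then show "\<rho> ^ card (insert u S) * c (insert u S) * chi (insert u S) x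
      = \<rho> * sg x u * (\<rho> ^ card S * c (insert u S) * chi S x)" by (simp add: chi_insert)
  qed
  then show ?thesis unfolding noisy_def sum_Pow_insert[OF assms] by (simp add: sum_distrib_left)
qed

text \<open>The statement for a list of functions replaces Minkowski's inequality in the induction: one
  variable is removed at the cost of doubling the list.\<close>

lemma hypercontractive_list:
  assumes k: "k > 0" and \<rho>: "0 \<le> \<rho>" "\<rho>\<^sup>2 * (1 + 4 * 2 ^ k) = 1"
    and fin: "finite U" and U: "U \<subseteq> {1..n}"
  shows "avg n (\<lambda>x. (\<Sum>c\<leftarrow>cs. (noisy \<rho> U c x)\<^sup>2) ^ k) \<le> (\<Sum>c\<leftarrow>cs. \<Sum>S\<in>Pow U. (c S)\<^sup>2) ^ k"
  using fin U
proof (induction U arbitrary: cs rule: finite_induct)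
  case empty
  then show ?case by (simp add: noisy_def chi_def)
next
  case (insert u U)
  let ?Q = "\<lambda>c x. noisy \<rho> U c x"
  let ?s = "\<lambda>c S. c (insert u S)"
  let ?F = "\<lambda>x. (\<Sum>c\<leftarrow>cs. (noisy \<rho> (insert u U) c x)\<^sup>2) ^ k"
  let ?P = "\<lambda>x. \<Sum>c\<leftarrow>cs. (?Q c x)\<^sup>2" and ?H = "\<lambda>x. \<Sum>c\<leftarrow>cs. (?Q (?s c) x)\<^sup>2"
  let ?X = "\<lambda>x. \<Sum>c\<leftarrow>cs. ?Q c x * ?Q (?s c) x"
  have u: "u \<in> {1..n}" using insert by auto
  have F: "?F x = (?P x + \<rho>\<^sup>2 * ?H x + sg x u * (2 * \<rho> * ?X x)) ^ k" for x
  proof -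
    have "(noisy \<rho> (insert u U) c x)\<^sup>2
       = (?Q c x)\<^sup>2 + \<rho>\<^sup>2 * (?Q (?s c) x)\<^sup>2 + sg x u * (2 * \<rho>) * (?Q c x * ?Q (?s c) x)" for c
    proof -
      have "(\<rho> * sg x u * ?Q (?s c) x)\<^sup>2 = (sg x u * sg x u) * \<rho>\<^sup>2 * (?Q (?s c) x)\<^sup>2"
        by (simp only: power2_eq_square mult_ac)
      then show ?thesis unfolding noisy_insert[OF insert(1,2)] power2_sum by simp
    qed
    then show ?thesis by (simp add: sum_list_addf sum_list_const_mult mult.assoc)
  qed
  \<comment> \<open>The remaining polynomials do not involve \<open>u\<close>, so flipping
    \<open>u\<close> changes only the sign of the cross term, as \<open>two_point\<close>
    requires.\<close>
  have inv: "noisy \<rho> U c (flip u x) = noisy \<rho> U c x" for c x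
    unfolding noisy_def using insert(2) by (intro sum.cong refl) (metis PowD chi_flip_notin subsetD)
  have "avg n ?F = (avg n ?F + avg n (\<lambda>x. ?F (flip u x))) / 2"
    using avg_flip[OF u, of ?F] by simp
  also have "\<dots> = avg n (\<lambda>x. (1/2) * (?F x + ?F (flip u x)))"
    unfolding avg_cmult avg_add by simp
  also have "\<dots> \<le> avg n (\<lambda>x. (?P x + ?H x) ^ k)"
  proof (rule avg_mono)
    fix x assume x: "x \<in> cube n"
    have "((?P x + \<rho>\<^sup>2 * ?H x + 2 * \<rho> * ?X x) ^ k + (?P x + \<rho>\<^sup>2 * ?H x - 2 * \<rho> * ?X x) ^ k) / 2 \<le> (?P x + ?H x) ^ k"
      by (rule two_point[OF _ _ sum_list_Cauchy_Schwarz \<rho> k]) (auto intro!: sum_list_nonneg)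
    moreover have "sg x u = 1 \<or> sg x u = -1" using abs_sg[of x u] by linarith
    ultimately show "(1/2) * (?F x + ?F (flip u x)) \<le> (?P x + ?H x) ^ k"
      unfolding F inv sg_flip[OF x u] by auto
  qed
  also have "\<dots> = avg n (\<lambda>x. (\<Sum>c\<leftarrow>cs @ map ?s cs. (?Q c x)\<^sup>2) ^ k)"
    by (simp add: o_def)
  also have "\<dots> \<le> (\<Sum>c\<leftarrow>cs @ map ?s cs. \<Sum>S\<in>Pow U. (c S)\<^sup>2) ^ k"
    using insert by (intro insert.IH) auto
  also have "\<dots> = (\<Sum>c\<leftarrow>cs. \<Sum>S\<in>Pow (insert u U). (c S)\<^sup>2) ^ k"
    unfolding sum_Pow_insert[OF insert(1,2)] by (simp add: sum_list_addf o_def)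
  finally show ?case .
qed

lemma hypercontractive:
  assumes "k > 0" "0 \<le> \<rho>" "\<rho>\<^sup>2 * (1 + 4 * 2 ^ k) = 1"
  shows "avg n (\<lambda>x. (noisy \<rho> {1..n} c x) ^ (2 * k)) \<le> (\<Sum>S\<in>Pow {1..n}. (c S)\<^sup>2) ^ k"
  using hypercontractive_list[OF assms, of "{1..n}" n "[c]"] by (simp add: power_mult)

section \<open>Influences\<close>

lemma influence_bounds: "0 \<le> influence n f i" "influence n f i \<le> 1"
  by (simp_all add: influence_def measure_pmf.prob_le_1)

text \<open>With weights \<open>w i\<close>, morally the influence to the power
  \<open>1/p - 1\<close>, the sum \<open>K\<close> is the mean total weight of the sensitive
  coordinates. Hoelder bounds it by \<open>K powr (1 - p) * A\<close>, and dividing gives the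
  claim.\<close>

lemma sum_influence_powr_le:
  assumes p: "0 < p" "p \<le> 1" and A: "avg n (\<lambda>x. real (sensitivity n f x) powr p) \<le> A"
  shows "(\<Sum>i\<in>{1..n}. influence n f i powr (1 / p)) \<le> A powr (1 / p)"
proof -
  let ?I = "influence n f"
  let ?V = "\<lambda>x. {i\<in>{1..n}. f (flip i x) \<noteq> f x}"
  define K where "K = (\<Sum>i\<in>{1..n}. ?I i powr (1 / p))"
  define w where "w i = (?I i powr (1 / p)) powr (1 - p)" for i
  have w: "?I i powr (1 / p) = w i * ?I i" for i
  proof (cases "?I i = 0")
    case False
    then have "w i * ?I i = ?I i powr (1 / p * (1 - p)) * ?I i powr 1"
      using influence_bounds[of n f i] by (simp add: w_def powr_powr)
    also have "\<dots> = ?I i powr (1 / p)"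
      unfolding powr_add[symmetric] using p by (simp add: field_simps)
    finally show ?thesis ..
  qed simp
  have "K = (\<Sum>i\<in>{1..n}. avg n (\<lambda>x. w i * (if f x \<noteq> f (flip i x) then 1 else 0)))"
    unfolding K_def w avg_cmult influence_eq[symmetric] ..
  also have "\<dots> = avg n (\<lambda>x. \<Sum>i\<in>?V x. w i)"
    unfolding avg_sum[symmetric]
    by (intro avg_cong) (subst sum.inter_filter, auto intro!: sum.cong)
  also have "\<dots> \<le> avg n (\<lambda>x. K powr (1 - p) * real (sensitivity n f x) powr p)"
  proof (rule avg_mono)
    fix x
    show "(\<Sum>i\<in>?V x. w i) \<le> K powr (1 - p) * real (sensitivity n f x) powr p"
      unfolding w_def sensitivity_def
      by (rule sum_powr_le) (use p in \<open>auto simp: K_def intro!: sum_mono2\<close>)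
  qed
  also have "\<dots> \<le> K powr (1 - p) * A"
    unfolding avg_cmult using A by (intro mult_left_mono) auto
  finally have K: "K \<le> K powr (1 - p) * A" .
  have "K \<le> A powr (1 / p)"
  proof (cases "K > 0")
    case True
    then have "K powr (1 - p) * K powr p \<le> K powr (1 - p) * A"
      using K by (simp flip: powr_add)
    then have "K powr p \<le> A" using True by simp
    then have "(K powr p) powr (1 / p) \<le> A powr (1 / p)" using p by (intro powr_mono2) auto
    then show ?thesis using True p by (simp add: powr_powr)
  qed (use powr_ge_zero[of A "1 / p"] in linarith)
  then show ?thesis by (simp add: K_def)
qed

text \<open>Duality: the left side \<open>W\<close> is the correlation of \<open>f\<close> with an
  odd function \<open>g\<close> living on the boundary in direction \<open>i\<close>. Hoelder and
  hypercontractivity give \<open>W \<le> W powr (1/2) * ?I powr (1 - q)\<close>; cancelling the root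
  and squaring finishes.\<close>

lemma derivative_weight_le:
  assumes k: "k > 0" and \<rho>: "0 \<le> \<rho>" "\<rho>\<^sup>2 * (1 + 4 * 2 ^ k) = 1"
    and f: "f \<in> cube n \<rightarrow> {0, 1}" and i: "i \<in> {1..n}"
  shows "(\<Sum>S\<in>{S\<in>Pow {1..n}. i \<in> S}. \<rho> ^ (2 * card S) * (fcoef n f S)\<^sup>2)
    \<le> influence n f i powr (2 - 1 / k)"
proof -
  \<comment> \<open>One factor \<open>\<rho> ^ card S\<close> sits in \<open>c\<close>, the other
    comes from \<open>noisy\<close>; so the squared norm of \<open>c\<close> and the correlation of
    \<open>f\<close> with \<open>g\<close> are both \<open>W\<close>.\<close>
  define c where "c S = (if i \<in> S then \<rho> ^ card S * fcoef n f S else 0)" for S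
  define g where "g = noisy \<rho> {1..n} c"
  define W where "W = (\<Sum>S\<in>Pow {1..n}. (c S)\<^sup>2)"
  define q where "q = 1 / (2 * real k)"
  let ?I = "influence n f i"
  let ?V = "{x\<in>cube n. f x \<noteq> f (flip i x)}"
  have q: "0 < q" "q \<le> 1" using k by (auto simp: q_def)
  have W0: "0 \<le> W" unfolding W_def by (intro sum_nonneg) auto
  have W: "(\<Sum>S\<in>{S\<in>Pow {1..n}. i \<in> S}. \<rho> ^ (2 * card S) * (fcoef n f S)\<^sup>2) = W"
    unfolding W_def by (subst sum.inter_filter)
      (auto intro!: sum.cong simp: c_def power_mult_distrib power_mult[symmetric] mult.commute)
  have "avg n (\<lambda>x. f x * g x) = avg n (\<lambda>x. \<Sum>S\<in>Pow {1..n}. \<rho> ^ card S * c S * (f x * chi S x))"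
    by (simp only: g_def noisy_def sum_distrib_left mult_ac)
  also have "\<dots> = (\<Sum>S\<in>Pow {1..n}. \<rho> ^ card S * c S * fcoef n f S)"
    by (simp only: avg_sum avg_cmult fcoef_def)
  also have "\<dots> = W"
    unfolding W_def by (intro sum.cong refl) (auto simp: c_def power2_eq_square)
  finally have "W = avg n (\<lambda>x. f x * g x)" ..
  also have "\<dots> \<le> avg n (\<lambda>x. if f x \<noteq> f (flip i x) then \<bar>g x\<bar> else 0) / 2"
  proof (rule odd_correlation[OF i f])
    fix x assume x: "x \<in> cube n"
    show "g (flip i x) = - g x"
      unfolding g_def noisy_def sum_negf[symmetric]
    proof (intro sum.cong refl)
      fix S assume "S \<in> Pow {1..n}"
      then have "i \<in> S \<Longrightarrow> chi S (flip i x) = - chi S x"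
        using x i by (intro chi_flip_in) (auto intro: finite_subset)
      then show "\<rho> ^ card S * c S * chi S (flip i x) = - (\<rho> ^ card S * c S * chi S x)"
        by (auto simp: c_def)
    qed
  qed
  also have "\<dots> \<le> avg n (\<lambda>x. if f x \<noteq> f (flip i x) then \<bar>g x\<bar> else 0)"
    using avg_nonneg[of n "\<lambda>x. if f x \<noteq> f (flip i x) then \<bar>g x\<bar> else 0"] by simp
  also have "\<dots> = (\<Sum>x\<in>?V. \<bar>g x\<bar>) / 2 ^ n"
    by (simp add: avg_def sum.inter_filter)
  \<comment> \<open>Written as the \<open>q\<close>-th power of \<open>g x ^ (2 * k)\<close> to
    apply \<open>sum_powr_le\<close> with parameter \<open>1 - q\<close>.\<close>
  also have "(\<Sum>x\<in>?V. \<bar>g x\<bar>) = (\<Sum>x\<in>?V. (g x ^ (2 * k)) powr (1 - (1 - q)))"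
  proof (intro sum.cong refl)
    fix x
    show "\<bar>g x\<bar> = (g x ^ (2 * k)) powr (1 - (1 - q))"
    proof (cases "g x = 0")
      case False
      then have "g x ^ (2 * k) = \<bar>g x\<bar> powr (2 * real k)"
        using powr_realpow[of "\<bar>g x\<bar>" "2 * k"] by (simp add: power_even_abs)
      then show ?thesis using False k by (simp add: powr_powr q_def)
    qed (use k in simp)
  qed
  also have "\<dots> \<le> (2 ^ n * W ^ k) powr (1 - (1 - q)) * real (card ?V) powr (1 - q)"
  proof (rule sum_powr_le)
    have "(\<Sum>x\<in>?V. g x ^ (2 * k)) \<le> (\<Sum>x\<in>cube n. g x ^ (2 * k))"
      by (intro sum_mono2) (auto simp: zero_le_even_power)
    also have "\<dots> \<le> 2 ^ n * W ^ k"
      using hypercontractive[OF k \<rho>, of n c] by (simp add: avg_def g_def W_def field_simps)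
    finally show "(\<Sum>x\<in>?V. g x ^ (2 * k)) \<le> 2 ^ n * W ^ k" .
  qed (use q in \<open>auto simp: zero_le_even_power\<close>)
  also have "real (card ?V) = 2 ^ n * ?I"
    unfolding influence_eq avg_def by (simp add: sum.If_cases Int_def)
  also have "(2 ^ n * W ^ k) powr (1 - (1 - q)) * (2 ^ n * ?I) powr (1 - q) / 2 ^ n
      = W powr (1/2) * ?I powr (1 - q)"
  proof -
    have "(W ^ k) powr q = W powr (1/2)"
    proof (cases "W = 0")
      case False
      then have "W ^ k = W powr real k" using W0 by (simp add: powr_realpow)
      then show ?thesis using k by (simp add: powr_powr q_def)
    qed (use k in simp)
    moreover have "(2 ^ n) powr q * (2 ^ n) powr (1 - q) = (2 ^ n :: real)"
      by (simp flip: powr_add)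
    ultimately show ?thesis
      using W0 influence_bounds[of n f i] by (simp add: powr_mult field_simps)
  qed
  finally have le: "W \<le> W powr (1/2) * ?I powr (1 - q)"
    by (simp add: divide_right_mono)
  have "W \<le> ?I powr (2 - 1 / k)"
  proof (cases "W > 0")
    case True
    have "W powr (1/2) * W powr (1/2) = W" using True by (simp flip: powr_add)
    then have "W powr (1/2) * W powr (1/2) \<le> W powr (1/2) * ?I powr (1 - q)" using le by simp
    then have "W powr (1/2) \<le> ?I powr (1 - q)" using True by simp
    then have "(W powr (1/2))\<^sup>2 \<le> (?I powr (1 - q))\<^sup>2" by (intro power_mono) auto
    moreover have "(W powr (1/2))\<^sup>2 = W" using True by (simp add: powr_half_sqrt)
    moreover have "(?I powr (1 - q))\<^sup>2 = ?I powr (2 - 1 / k)"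
      by (simp add: power2_eq_square q_def flip: powr_add)
    ultimately show ?thesis by simp
  qed (use powr_ge_zero[of ?I "2 - 1 / k"] in linarith)
  then show ?thesis by (simp only: W)
qed

section \<open>Splitting the variance by level, and the choice of parameters\<close>

lemma variance_le_moment:
  assumes f: "f \<in> cube n \<rightarrow> {0, 1}" and p: "1/2 \<le> p" "p \<le> 1"
    and A: "avg n (\<lambda>x. real (sensitivity n f x) powr p) \<le> A"
  shows "var n f \<le> A"
proof -
  \<comment> \<open>This is the case \<open>r = 0\<close> of \<open>stability_diff_le\<close>;
    \<open>0 ^ 0 = 1\<close> makes the empty set drop out.\<close>
  have "var n f \<le> (\<Sum>S\<in>Pow {1..n}. (1 - 0 ^ card S) * (fcoef n f S)\<^sup>2)"
    unfolding variance_fourier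
  proof (rule sum_mono2[THEN order_trans[rotated], OF _ Diff_subset[of _ "{{}}"]])
    show "(\<Sum>S\<in>Pow {1..n} - {{}}. (fcoef n f S)\<^sup>2) \<le> (\<Sum>S\<in>Pow {1..n} - {{}}. (1 - 0 ^ card S) * (fcoef n f S)\<^sup>2)"
    proof (rule sum_mono)
      fix S assume "S \<in> Pow {1..n} - {{}}"
      then have "card S \<noteq> 0" using finite_subset[of S "{1..n}"] by auto
      then show "(fcoef n f S)\<^sup>2 \<le> (1 - 0 ^ card S) * (fcoef n f S)\<^sup>2"
        by (simp only: power_0_left) simp
    qed
  qed (auto simp: power_0_left)
  also have "\<dots> \<le> A" using stability_diff_le[OF f _ _ p A, of 0] by simp
  finally show ?thesis .
qed

text \<open>Each nonempty \<open>S\<close> is charged to one of two terms: levels from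
  \<open>d\<close> on to the noise-stability loss at \<open>r = 1 - 1/d\<close>, lower levels to the
  noisy derivative weights, which \<open>R ^ d\<close> compensates.\<close>

lemma variance_split:
  assumes f: "f \<in> cube n \<rightarrow> {0, 1}" and p: "1/2 \<le> p" "p \<le> 1" and d: "d > 0"
    and k: "k > 0" and A: "avg n (\<lambda>x. real (sensitivity n f x) powr p) \<le> A"
  shows "var n f \<le> 2 * A / real d powr p
    + (1 + 4 * 2 ^ k) ^ d * (\<Sum>i\<in>{1..n}. influence n f i powr (2 - 1 / k))"
proof -
  define r where "r = 1 - 1 / real d"
  define R where "R = 1 + 4 * (2::real) ^ k"
  define \<rho> where "\<rho> = sqrt (1 / R)"
  have R: "1 \<le> R" by (simp add: R_def)
  have \<rho>sq: "\<rho>\<^sup>2 = 1 / R" using R by (simp add: \<rho>_def)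
  have \<rho>: "0 \<le> \<rho>" "\<rho>\<^sup>2 * (1 + 4 * 2 ^ k) = 1" using R \<rho>sq unfolding R_def[symmetric] by (auto simp: \<rho>_def)
  have r: "0 \<le> r" "r \<le> 1" using d by (auto simp: r_def)
  have rd: "r ^ d \<le> 1/2"
  proof -
    have "r ^ d \<le> exp (- (1 / real d)) ^ d"
      using r(1) exp_ge_add_one_self[of "- (1 / real d)"] by (intro power_mono) (auto simp: r_def)
    also have "\<dots> = exp (-1)" using d by (simp flip: exp_of_nat_mult)
    also have "\<dots> \<le> 1/2" using exp_ge_add_one_self[of 1] by (simp add: exp_minus field_simps)
    finally show ?thesis .
  qed
  let ?a = "\<lambda>S. 2 * ((1 - r ^ card S) * (fcoef n f S)\<^sup>2)"
  \<comment> \<open>The factor \<open>card S\<close>, at least 1 here, lets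
    \<open>sum_over_elements\<close> turn this into a sum over coordinates.\<close>
  let ?b = "\<lambda>S. R ^ d * (real (card S) * (\<rho> ^ (2 * card S) * (fcoef n f S)\<^sup>2))"
  have nonneg: "0 \<le> ?a S" "0 \<le> ?b S" for S
    using r R by (auto simp: power_le_one power_mult)
  have "var n f \<le> (\<Sum>S\<in>Pow {1..n} - {{}}. ?a S + ?b S)"
    unfolding variance_fourier
  proof (rule sum_mono)
    fix S assume "S \<in> Pow {1..n} - {{}}"
    then have S: "card S \<ge> 1" using finite_subset[of S "{1..n}"] by (simp add: Suc_le_eq card_gt_0_iff)
    show "(fcoef n f S)\<^sup>2 \<le> ?a S + ?b S"
    proof (cases "card S < d")
      case True
      have "1 \<le> R ^ (d - card S)" using R by simp
      also have "\<dots> = R ^ d * \<rho> ^ (2 * card S)"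
        using True R by (simp add: power_mult \<rho>sq power_diff power_one_over)
      also have "\<dots> \<le> R ^ d * \<rho> ^ (2 * card S) * real (card S)"
        using S R \<rho>(1) mult_left_mono[of 1 "real (card S)" "R ^ d * \<rho> ^ (2 * card S)"] by simp
      finally have "1 * (fcoef n f S)\<^sup>2 \<le> R ^ d * \<rho> ^ (2 * card S) * real (card S) * (fcoef n f S)\<^sup>2"
        by (intro mult_right_mono) auto
      then show ?thesis using nonneg(1)[of S] by (simp add: mult_ac)
    next
      case False
      then have "r ^ card S \<le> 1/2" using rd power_decreasing[of d "card S" r] r by auto
      then have "1 * (fcoef n f S)\<^sup>2 \<le> (2 * (1 - r ^ card S)) * (fcoef n f S)\<^sup>2"
        by (intro mult_right_mono) auto
      then show ?thesis using nonneg(2)[of S] by linarith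
    qed
  qed
  also have "\<dots> \<le> (\<Sum>S\<in>Pow {1..n}. ?a S + ?b S)"
    using nonneg by (intro sum_mono2) (auto intro: add_nonneg_nonneg)
  also have "\<dots> = 2 * (\<Sum>S\<in>Pow {1..n}. (1 - r ^ card S) * (fcoef n f S)\<^sup>2)
      + R ^ d * (\<Sum>i\<in>{1..n}. \<Sum>S\<in>{S\<in>Pow {1..n}. i \<in> S}. \<rho> ^ (2 * card S) * (fcoef n f S)\<^sup>2)"
    unfolding sum_over_elements by (simp only: sum.distrib sum_distrib_left)
  also have "\<dots> \<le> 2 * (A * (1 - r) powr p) + R ^ d * (\<Sum>i\<in>{1..n}. influence n f i powr (2 - 1 / k))"
    using R by (intro add_mono mult_left_mono sum_mono stability_diff_le[OF f r p A]
      derivative_weight_le[OF k \<rho> f]) auto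
  also have "2 * (A * (1 - r) powr p) = 2 * A / real d powr p"
    by (simp add: r_def powr_divide)
  finally show ?thesis by (simp add: R_def)
qed

lemma variance_pos:
  assumes "\<not> f constant_on cube n"
  shows "0 < var n f"
proof -
  define a where "a = avg n f"
  obtain x where x: "x \<in> cube n" "f x \<noteq> a" using assms by (auto simp: constant_on_def)
  have "avg n (\<lambda>x. (f x - a)\<^sup>2) = avg n (\<lambda>x. (f x)\<^sup>2 - 2 * a * f x + a\<^sup>2)"
    by (intro avg_cong) (simp add: power2_diff mult_ac)
  also have "\<dots> = var n f"
    unfolding avg_add avg_diff avg_cmult avg_const var_def expectation_unif a_def[symmetric]
    by (simp add: power2_eq_square)
  finally have "var n f = (\<Sum>x\<in>cube n. (f x - a)\<^sup>2) / 2 ^ n" by (simp add: avg_def)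
  also have "\<dots> > 0" using x by (intro divide_pos_pos sum_pos2[of _ x]) auto
  finally show ?thesis .
qed

lemma variance_le_1:
  assumes "f \<in> cube n \<rightarrow> {0, 1}"
  shows "var n f \<le> 1"
proof -
  have "avg n (\<lambda>x. (f x)\<^sup>2) \<le> avg n (\<lambda>x. 1)"
    using assms by (intro avg_mono) (auto simp: Pi_def)
  then show ?thesis by (simp add: var_def expectation_unif) (smt (verit) zero_le_power2)
qed

text \<open>Absorbs a linear factor \<open>B\<close> into the exponential at the end of the
  argument.\<close>

lemma le_two_powr:
  fixes B :: real
  assumes "1 \<le> B"
  shows "B \<le> 2 powr B"
proof -
  have "ln (B / 2) \<le> B / 2 - 1" using assms by (intro ln_le_minus_one) auto
  moreover have "ln (1 / 2 :: real) \<le> 1 / 2 - 1" by (intro ln_le_minus_one) auto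
  ultimately have "ln B \<le> B / 2 - 1 + ln 2" "1 / 2 \<le> ln (2::real)" using assms by (auto simp: ln_div)
  moreover have "ln (2::real) \<le> 1" using ln_le_minus_one[of 2] by simp
  moreover have "B * (1 / 2) \<le> B * ln 2" using assms calculation by (intro mult_left_mono) auto
  ultimately have "ln B \<le> B * ln 2" by linarith
  then show ?thesis using assms ln_le_cancel_iff[of B "2 powr B"] by (simp add: ln_powr)
qed

lemma exists_large_influence:
  assumes f: "f \<in> cube n \<rightarrow> {0, 1}" and V: "0 < var n f" and p: "1/2 \<le> p" "p \<le> 1"
    and k: "k > 0" "1 / p + 2 / real k \<le> 2"
    and A: "avg n (\<lambda>x. real (sensitivity n f x) powr p) \<le> A"
  shows "\<exists>i\<in>{1..n}. 2 powr (- (real k * (17 * (real k + 3) + 3)) * (A / var n f) powr (1 / p)) \<le> influence n f i"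
proof (rule ccontr)
  define V where "V = var n f"
  define B where "B = (A / V) powr (1 / p)"
  \<comment> \<open>The part \<open>17 * (real k + 3)\<close> pays for \<open>R ^ d\<close>, the 3
    absorbs a factor \<open>B\<close> and leaves \<open>2 powr (- 2 * B)\<close>, and the outer
    \<open>k\<close> undoes the root in \<open>m powr (1 / k)\<close>.\<close>
  define c where "c = real k * (17 * (real k + 3) + 3)"
  define m where "m = 2 powr (- c * B)"
  define R where "R = 1 + 4 * (2::real) ^ k"
  \<comment> \<open>The level at which the high part \<open>2 * A / real d powr p\<close> is at most
    \<open>V / 2\<close>.\<close>
  define d where "d = nat \<lceil>(4 * A / V) powr (1 / p)\<rceil>"
  let ?I = "influence n f"
  assume no: "\<not> ?thesis"
  have small: "?I i \<le> m" if "i \<in> {1..n}" for i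
  proof -
    have "\<not> m \<le> ?I i"
      using no that unfolding m_def c_def B_def V_def by blast
    then show ?thesis by simp
  qed
  have V0: "0 < V" and V1: "V \<le> 1" and VA: "V \<le> A"
    using V variance_le_1[OF f] variance_le_moment[OF f p A] by (auto simp: V_def)
  have B1: "1 \<le> B" using V0 VA p unfolding B_def by (intro ge_one_powr_ge_zero) auto
  have "(4 * A / V) powr (1 / p) = 4 powr (1 / p) * B"
    using V0 VA by (simp add: B_def powr_mult flip: times_divide_eq_right)
  also have "4 powr (1 / p) \<le> (4::real) powr 2" using p by (intro powr_mono) (auto simp: field_simps)
  finally have le16: "(4 * A / V) powr (1 / p) \<le> 16 * B" using B1 by simp
  have pos: "0 < (4 * A / V) powr (1 / p)" using V0 VA by simp
  have d0: "d > 0" using pos unfolding d_def by simp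
  have d_ge: "(4 * A / V) powr (1 / p) \<le> real d" unfolding d_def by linarith
  \<comment> \<open>Rounding up costs at most 1, which is at most \<open>B\<close>.\<close>
  have d_le: "real d \<le> 17 * B" using le16 pos B1 unfolding d_def by linarith
  have "4 * A / V = ((4 * A / V) powr (1 / p)) powr p"
    using V0 VA p by (simp add: powr_powr)
  also have "\<dots> \<le> real d powr p" using d_ge p pos by (intro powr_mono2) auto
  finally have "2 * A / real d powr p \<le> V / 2"
    using V0 d0 by (simp add: field_simps)
  moreover have "V \<le> 2 * A / real d powr p + R ^ d * (\<Sum>i\<in>{1..n}. ?I i powr (2 - 1 / k))"
    unfolding V_def R_def by (rule variance_split[OF f p d0 k(1) A])
  moreover have "(\<Sum>i\<in>{1..n}. ?I i powr (2 - 1 / k)) \<le> m powr (1 / k) * (B * V)"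
  proof -
    have "(\<Sum>i\<in>{1..n}. ?I i powr (2 - 1 / k)) \<le> (\<Sum>i\<in>{1..n}. m powr (1 / k) * ?I i powr (1 / p))"
    proof (rule sum_mono)
      fix i assume i: "i \<in> {1..n}"
      \<comment> \<open>The hypothesis on \<open>k\<close> leaves a spare power \<open>1 / k\<close>
        of the influence, bounded by the assumed maximum \<open>m\<close>.\<close>
      have "?I i powr (2 - 1 / k) \<le> ?I i powr (1 / k + 1 / p)"
        using k influence_bounds[of n f i] by (intro powr_mono') auto
      also have "\<dots> = ?I i powr (1 / k) * ?I i powr (1 / p)" by (rule powr_add)
      also have "\<dots> \<le> m powr (1 / k) * ?I i powr (1 / p)"
        using small[OF i] influence_bounds[of n f i] by (intro mult_right_mono powr_mono2) auto
      finally show "?I i powr (2 - 1 / k) \<le> m powr (1 / k) * ?I i powr (1 / p)" .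
    qed
    also have "\<dots> \<le> m powr (1 / k) * A powr (1 / p)"
      unfolding sum_distrib_left[symmetric] using p
      by (intro mult_left_mono sum_influence_powr_le[OF _ _ A]) auto
    also have "A powr (1 / p) = B * V powr (1 / p)"
      using V0 VA by (simp add: B_def powr_divide)
    \<comment> \<open>Since \<open>V \<le> 1\<close> and \<open>1 / p \<ge> 1\<close>, one full
      factor \<open>V\<close> remains and cancels the variance on the left.\<close>
    also have "m powr (1 / k) * (B * V powr (1 / p)) \<le> m powr (1 / k) * (B * V powr 1)"
      using V0 V1 p B1 by (intro mult_left_mono powr_mono') auto
    finally show ?thesis using V0 by simp
  qed
  then have "R ^ d * (\<Sum>i\<in>{1..n}. ?I i powr (2 - 1 / k)) \<le> R ^ d * (m powr (1 / k) * (B * V))"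
    by (rule mult_left_mono) (simp add: R_def)
  ultimately have "V / 2 \<le> R ^ d * (m powr (1 / k) * (B * V))" by linarith
  then have "1 / 2 \<le> R ^ d * (m powr (1 / k) * B)"
    using V0 by (simp add: field_simps)
  also have "\<dots> \<le> 2 powr ((real k + 3) * (17 * B)) * (2 powr (- (17 * (real k + 3) + 3) * B) * 2 powr B)"
  proof (intro mult_mono)
    have "2 powr (real k + 3) = 8 * (2::real) ^ k" by (simp add: powr_add powr_realpow)
    moreover have "1 \<le> (2::real) ^ k" by simp
    ultimately have "R \<le> 2 powr (real k + 3)" unfolding R_def by linarith
    then have "R ^ d \<le> (2 powr (real k + 3)) ^ d" by (intro power_mono) (auto simp: R_def)
    also have "\<dots> = 2 powr ((real k + 3) * real d)" by (simp add: powr_power mult.commute)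
    also have "\<dots> \<le> 2 powr ((real k + 3) * (17 * B))"
      using d_le by (intro powr_mono mult_left_mono) auto
    finally show "R ^ d \<le> 2 powr ((real k + 3) * (17 * B))" .
    show "m powr (1 / k) \<le> 2 powr (- (17 * (real k + 3) + 3) * B)"
      using k by (simp add: m_def powr_powr c_def algebra_simps)
    show "B \<le> 2 powr B" using B1 by (rule le_two_powr)
  qed (use B1 in \<open>auto simp: R_def\<close>)
  also have "\<dots> = 2 powr (- 2 * B)" by (simp add: algebra_simps flip: powr_add)
  also have "\<dots> \<le> 2 powr (-2)" using B1 by (intro powr_mono) auto
  finally show False by (simp add: powr_minus)
qed

theorem corollary1p6:
  fixes \<delta> :: real
  assumes "\<delta> > 0"
  shows "\<exists>c::real. c > 0 \<and>
    (\<forall>p\<in>{1/2 + \<delta>..1}. \<forall>(n::nat) (A::real) (f :: (nat \<Rightarrow> nat) \<Rightarrow> real).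
       n > 0 \<longrightarrow> A > 0 \<longrightarrow> f \<in> cube n \<rightarrow> {0, 1} \<longrightarrow> \<not> f constant_on cube n \<longrightarrow>
       measure_pmf.expectation (unif n) (\<lambda>x. real (sensitivity n f x) powr p) \<le> A \<longrightarrow>
       (\<exists>i\<in>{1..n}. influence n f i \<ge> 2 powr (- c * (A / var n f) powr (1 / p))))"
proof -
  \<comment> \<open>Chosen so that \<open>1 / p + 2 / k \<le> 2\<close> at the smallest exponent
    \<open>p = 1/2 + \<delta>\<close>, hence for all larger ones; \<open>k\<close> depends on
    \<delta> alone, and so does the constant.\<close>
  define k where "k = nat \<lceil>(1 + 2 * \<delta>) / (2 * \<delta>)\<rceil>"
  have "0 < (1 + 2 * \<delta>) / (2 * \<delta>)" using assms by simp
  then have k0: "k > 0" and k: "(1 + 2 * \<delta>) / (2 * \<delta>) \<le> real k" unfolding k_def by (simp, linarith)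
  have kp: "1 / p + 2 / real k \<le> 2" if "1/2 + \<delta> \<le> p" for p
  proof -
    have "2 / real k \<le> 2 / ((1 + 2 * \<delta>) / (2 * \<delta>))"
      using k k0 assms by (intro divide_left_mono) auto
    moreover have "1 / p \<le> 1 / (1/2 + \<delta>)" using that assms by (intro divide_left_mono) auto
    moreover have "1 / (1/2 + \<delta>) + 2 / ((1 + 2 * \<delta>) / (2 * \<delta>)) = 2"
      using assms by (simp add: divide_simps) (simp add: algebra_simps)
    ultimately show ?thesis by linarith
  qed
  show ?thesis
  proof (intro exI[of _ "real k * (17 * (real k + 3) + 3)"] conjI ballI allI impI)
    show "0 < real k * (17 * (real k + 3) + 3)" using k0 by simp
  next
    fix p n A and f :: "(nat \<Rightarrow> nat) \<Rightarrow> real"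
    assume "p \<in> {1/2 + \<delta>..1}" "f \<in> cube n \<rightarrow> {0, 1}" "\<not> f constant_on cube n"
      "measure_pmf.expectation (unif n) (\<lambda>x. real (sensitivity n f x) powr p) \<le> A"
    then show "\<exists>i\<in>{1..n}. influence n f i \<ge> 2 powr (- (real k * (17 * (real k + 3) + 3)) * (A / var n f) powr (1 / p))"
      using assms k0 kp by (intro exists_large_influence variance_pos) (auto simp: expectation_unif)
  qed
qed

end
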